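(* Let $u\in\mathcal A^{k,r}$, $u(x)=(\sum_j\theta_j(x^{(j)}))^k$, $d=kr$, and suppose that either $r\in(0,1)$, $k\in(0,\frac1r]$, or $r<0$, $k\in[\frac1r,0)$. Let $v=-\log u$, let $p>0$, let $x(p)$ be the best response and let $\gamma\in\Delta_n$ be given by $\gamma^{(j)}=\theta_j(x^{(j)})/\sum_l\theta_l(x^{(l)})$ evaluated at $x=x(p)$. Write $P=\mathrm{diag}(p)$, $X(p)=\mathrm{diag}(x(p))$, $\Gamma=\mathrm{diag}(\gamma)$. Then $$\gamma=\frac{X(p)p}{w}\in\Delta_n.$$ The primal Hessian at the best response is $$\nabla^2v(x(p))=d(1-r)\frac1{w^2}P\Gamma^{-1}P+\frac{dr}{w^2}pp^\top.$$ The dual Hessian is $$\nabla^2f(p)=\frac{d^2}{w^2}\big(\nabla^2v(x(p))\big)^{-1}=\frac d{1-r}P^{-1}(\Gamma-r\gamma\gamma^\top)P^{-1}.$$ The Jacobian of the best-response mapping is $$\nabla x(p)=-\frac wd\nabla^2f(p)=-\frac w{1-r}P^{-1}(\Gamma-r\gamma\gamma^\top)P^{-1}.$$ In particular these three matrices are each a diagonal matrix plus a rank-one matrix (DR1).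
   Context: $u\in\mathcal A^{k,r}$ (for real $k\neq0,r\ne0$ with $d=kr>0$) means $u(x)=(\sum_{j=1}^n\theta_j(x^{(j)}))^k$ where each $\theta_j$ is nonnegative, continuous and homogeneous of order $r$ ($\theta_j(\alpha t)=\alpha^r\theta_j(t)$ for $\alpha>0$). For a budget $w>0$, $f(p)=\max\{-v(x):x\in\mathbb R^n_+,\ \langle p,x\rangle\le w\}$, and $x(p)$ is its unique maximizer (the best response). $\Delta_n$ is the unit simplex. In the formulas containing $\Gamma^{-1}$ or $(\nabla^2v)^{-1}$, $\Gamma$ is understood to be invertible, i.e. all entries of $\gamma$ are positive. *)

theory Defs
  imports "HOL-Analysis.Analysis"
begin

definition jacobian_at :: "(real^'n \<Rightarrow> real^'m) \<Rightarrow> real^'n \<Rightarrow> real^'n^'m" where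
  "jacobian_at g x = matrix (frechet_derivative g (at x))"

definition gradient :: "(real^'n \<Rightarrow> real) \<Rightarrow> real^'n \<Rightarrow> real^'n" where
  "gradient F x = (THE D. GDERIV F x :> D)"

definition hessian :: "(real^'n \<Rightarrow> real) \<Rightarrow> real^'n \<Rightarrow> real^'n^'n" where
  "hessian F x = jacobian_at (gradient F) x"

definition twice_differentiable_at :: "(real^'n \<Rightarrow> real) \<Rightarrow> real^'n \<Rightarrow> bool" where
  "twice_differentiable_at F x \<longleftrightarrow>
     (\<forall>\<^sub>F y in nhds x. F differentiable (at y)) \<and> gradient F differentiable (at x)"

definition diag :: "real^'n \<Rightarrow> real^'n^'n" where
  "diag a = (\<chi> i j. if i = j then a $ i else 0)"

definition outer :: "real^'n \<Rightarrow> real^'n \<Rightarrow> real^'n^'n" where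
  "outer a b = columnvector a ** (rowvector b :: real^'n^1)"

definition DR1 :: "real^'n^'n \<Rightarrow> bool" where
  "DR1 M \<longleftrightarrow> (\<exists>a R. rank R = 1 \<and> M = diag a + R)"

definition unit_simplex :: "(real^'n) set" where
  "unit_simplex = {g. (\<forall>j. 0 \<le> g $ j) \<and> (\<Sum>j\<in>UNIV. g $ j) = 1}"

definition orthant :: "(real^'n) set" where
  "orthant = {x. \<forall>j. 0 \<le> x $ j}"

text \<open>
  For \<open>r < 0\<close> a nonzero homogeneous function of order \<open>r\<close> (such as \<open>t powr r\<close>) tends to
  infinity at 0. Hence the components take values in \<open>[0, \<infinity>]\<close> on the closed half-line; they are
  finite on the open half-line, and the value at 0 is governed by continuity (it is 0 for \<open>r > 0\<close>).
\<close>

definition homogeneous_component :: "real \<Rightarrow> (real \<Rightarrow> ennreal) \<Rightarrow> bool" where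
  "homogeneous_component r \<theta> \<longleftrightarrow>
     continuous_on {0..} \<theta> \<and> (\<forall>t>0. \<theta> t < \<infinity>) \<and>
     (\<forall>\<alpha>>0. \<forall>t\<ge>0. \<theta> (\<alpha> * t) = ennreal (\<alpha> powr r) * \<theta> t)"

text \<open>Real powers and the logarithm on \<open>[0, \<infinity>]\<close>, with limiting values at 0 and infinity.
  The exponent is meant to be nonzero.\<close>

definition epowr :: "ennreal \<Rightarrow> real \<Rightarrow> ennreal" where
  "epowr s k =
     (if s = 0 then (if 0 < k then 0 else \<infinity>)
      else if s = \<infinity> then (if 0 < k then \<infinity> else 0)
      else ennreal (enn2real s powr k))"

definition elog :: "ennreal \<Rightarrow> ereal" where
  "elog s = (if s = 0 then - \<infinity> else if s = \<infinity> then \<infinity> else ereal (ln (enn2real s)))"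

definition in_class_A ::
  "real \<Rightarrow> real \<Rightarrow> ('n \<Rightarrow> real \<Rightarrow> ennreal) \<Rightarrow> (real^'n \<Rightarrow> ennreal) \<Rightarrow> bool" where
  "in_class_A k r \<theta> u \<longleftrightarrow>
     k \<noteq> 0 \<and> r \<noteq> 0 \<and> 0 < k * r \<and> (\<forall>j. homogeneous_component r (\<theta> j)) \<and>
     (\<forall>x\<in>orthant. u x = epowr (\<Sum>j\<in>UNIV. \<theta> j (x $ j)) k)"

definition budget_set :: "real \<Rightarrow> real^'n \<Rightarrow> (real^'n) set" where
  "budget_set w p = {x \<in> orthant. p \<bullet> x \<le> w}"

text \<open>The supremum is a maximum whenever a best response exists.\<close>

definition opt_value :: "(real^'n \<Rightarrow> ereal) \<Rightarrow> real \<Rightarrow> real^'n \<Rightarrow> ereal" where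
  "opt_value v w p = (SUP x\<in>budget_set w p. - v x)"

definition best_response :: "(real^'n \<Rightarrow> ereal) \<Rightarrow> real \<Rightarrow> real^'n \<Rightarrow> real^'n" where
  "best_response v w p =
     (THE x. x \<in> budget_set w p \<and> (\<forall>y\<in>budget_set w p. - v y \<le> - v x))"

definition shares :: "('n \<Rightarrow> real \<Rightarrow> ennreal) \<Rightarrow> real^'n \<Rightarrow> real^'n" where
  "shares \<theta> x = (\<chi> j. enn2real (\<theta> j (x $ j)) / enn2real (\<Sum>l\<in>UNIV. \<theta> l (x $ l)))"

end

theory Submission
  imports Defs "HOL-Real_Asymp.Real_Asymp"
begin

text \<open>
  Homogeneity and continuity force \<open>\<theta>\<^sub>j(t) = a\<^sub>j t\<^sup>r\<close> with \<open>a\<^sub>j \<ge> 0\<close>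
  (\<open>homogeneous_component_eq\<close>), so the utility is a CES utility: maximising it means maximising
  \<open>(\<Sum>\<^sub>j a\<^sub>j x\<^sub>j\<^sup>r) / r\<close>, a strictly concave objective for either sign of \<open>r\<close>. The first-order
  conditions can be solved explicitly. With \<open>s = 1 / (1 - r)\<close> and
  \<open>Z(q) = \<Sum>\<^sub>j a\<^sub>j\<^sup>s q\<^sub>j\<^sup>1\<^sup>-\<^sup>s\<close> the solution is \<open>x\<^sub>j(q) = w a\<^sub>j\<^sup>s q\<^sub>j\<^sup>-\<^sup>s / Z(q)\<close>, and comparing each summand
  with its tangent shows that it is the only maximiser (\<open>demand_optimal\<close>, \<open>log_utility_less\<close>). This
  includes goods with \<open>a\<^sub>j = 0\<close>, which are not bought at all. The first-order conditions also say
  that \<open>a\<^sub>j x\<^sub>j\<^sup>r\<close> is proportional to \<open>q\<^sub>j x\<^sub>j\<close> (\<open>demand_value\<close>), which is \<open>\<gamma> = X p / w\<close>.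

  Substituting the solution gives \<open>f(q) = k (1 - r) ln Z(q) + d ln w\<close>. Hence \<open>v\<close>, where it is
  smooth, and \<open>f\<close> are both multiples of the logarithm of a power sum, with exponents \<open>r\<close> and
  \<open>1 - s\<close>, plus a constant. The Hessian of such a function is computed once
  (\<open>hessian_ln_power_sum\<close>): its diagonal and rank-one parts are expressed by the shares of the
  summands, and at corresponding points the two power sums have the same shares \<open>\<gamma>\<close>. The demand is
  itself \<open>- w / d\<close> times the gradient of \<open>f\<close>, so its Jacobian comes from the same computation.
  Finally, the two Hessians are inverse to each other up to the factor \<open>d\<^sup>2 / w\<^sup>2\<close> by a
  Sherman--Morrison computation (\<open>diag_plus_outer_inverse\<close>), using \<open>\<Sum>\<^sub>j \<gamma>\<^sub>j = 1\<close>.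
\<close>

section \<open>Diagonal plus rank-one matrices\<close>

lemma matrix_mult_diag_left: "(diag a ** M) $ i $ j = a $ i * M $ i $ j"
  by (simp add: matrix_matrix_mult_def diag_def if_distrib[of "\<lambda>t. t * _"] cong: if_cong)

lemma matrix_mult_diag_right: "(M ** diag a) $ i $ j = M $ i $ j * a $ j"
  by (simp add: matrix_matrix_mult_def diag_def if_distrib[of "\<lambda>t. _ * t"] cong: if_cong)

lemma outer_nth: "outer a b $ i $ j = a $ i * b $ j"
  by (simp add: outer_def matrix_matrix_mult_def columnvector_def rowvector_def)

lemma diag_nth: "diag a $ i $ j = (if i = j then a $ i else 0)"
  by (simp add: diag_def)

lemma diag_mult_vec: "(diag a *v h) $ i = a $ i * h $ i"
  by (simp add: matrix_vector_mult_def diag_def if_distrib[of "\<lambda>t. t * _"] cong: if_cong)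

lemma outer_mult_vec: "outer a b *v h = (b \<bullet> h) *\<^sub>R a"
  by (simp add: vec_eq_iff matrix_vector_mult_def outer_nth inner_vec_def sum_distrib_right sum_distrib_left mult_ac)

text \<open>For square matrices a one-sided inverse is two-sided, so checking one product identifies
  the inverse.\<close>
lemma matrix_inv_eqI:
  fixes A B :: "real^'n^'n"
  assumes "A ** B = mat 1"
  shows "matrix_inv A = B" "invertible A"
proof -
  have "B ** A = mat 1"
    using assms by (simp add: matrix_left_right_inverse)
  with assms show inv: "invertible A"
    unfolding invertible_def by blast
  have "matrix_inv A ** A = mat 1"
    unfolding matrix_inv_def by (rule someI2_ex) (use inv in \<open>auto simp: invertible_def\<close>)
  hence "matrix_inv A ** (A ** B) = B"
    by (simp add: matrix_mul_assoc)
  with assms show "matrix_inv A = B"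
    by simp
qed

lemma matrix_inv_diag:
  assumes "\<And>j. a $ j \<noteq> 0"
  shows "matrix_inv (diag a) = diag (\<chi> j. 1 / a $ j)"
  by (rule matrix_inv_eqI)
    (use assms in \<open>auto simp: vec_eq_iff matrix_mult_diag_left diag_nth mat_def\<close>)

text \<open>An outer product factors through a single column, which bounds its rank by one.\<close>
lemma rank_outer:
  fixes a b :: "real^'n"
  assumes "a \<noteq> 0" "b \<noteq> 0"
  shows "rank (outer a b) = 1"
proof -
  have "outer a b \<noteq> 0"
    using assms by (auto simp: vec_eq_iff outer_nth)
  hence "rank (outer a b) \<noteq> 0"
    by (simp add: rank_eq_0)
  moreover have "rank (outer a b) \<le> rank (columnvector a :: real^1^'n)"
    unfolding outer_def by (rule rank_mul_le_left)
  moreover have "rank (columnvector a :: real^1^'n) \<le> 1"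
    using rank_bound[of "columnvector a :: real^1^'n"] by simp
  ultimately show ?thesis
    by linarith
qed

lemma DR1_diag_plus_outer:
  assumes "c \<noteq> 0" "a \<noteq> 0"
  shows "DR1 (diag s + c *\<^sub>R outer a a)"
proof -
  have "c *\<^sub>R outer a a = outer (c *\<^sub>R a) a"
    by (simp add: vec_eq_iff outer_nth)
  moreover have "rank (outer (c *\<^sub>R a) a) = 1"
    using assms by (intro rank_outer) auto
  ultimately show ?thesis
    unfolding DR1_def by metis
qed

text \<open>A Sherman--Morrison formula in the form that makes the primal and the dual Hessian inverse to
  each other. The vectors \<open>p\<close> and \<open>g\<close> are normalised to have inner product one, and up to the factor
  \<open>\<mu>\<close> the diagonal part \<open>diag \<alpha>\<close> maps \<open>g\<close> to \<open>p\<close>. Every rank-one contribution to the product is then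
  a multiple of the single matrix \<open>outer p g\<close>, and the last hypothesis says that these multiples
  cancel.\<close>
lemma diag_plus_outer_inverse:
  fixes p g \<alpha> \<beta> :: "real^'n"
  assumes \<mu>: "\<mu> \<noteq> 0" and pg: "p \<bullet> g = 1"
    and \<alpha>: "\<And>j. \<alpha> $ j * g $ j = \<mu> * p $ j"
    and \<beta>: "\<And>j. \<mu> * (p $ j * \<beta> $ j) = g $ j"
    and \<alpha>\<beta>: "\<And>j. \<alpha> $ j * \<beta> $ j = 1"
    and st: "\<mu> * t + s / \<mu> + s * t = 0"
  shows "(diag \<alpha> + s *\<^sub>R outer p p) ** (diag \<beta> + t *\<^sub>R outer g g) = mat 1"
proof -
  have "((diag \<alpha> + s *\<^sub>R outer p p) *v ((diag \<beta> + t *\<^sub>R outer g g) *v h)) $ i = h $ i" for h i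
  proof -
    define y where "y = (diag \<beta> + t *\<^sub>R outer g g) *v h"
    have y: "y $ j = \<beta> $ j * h $ j + t * (g \<bullet> h) * g $ j" for j
      by (simp add: y_def matrix_vector_mult_add_rdistrib scaleR_matrix_vector_assoc[symmetric]
          diag_mult_vec outer_mult_vec)
    have "p $ j * y $ j = g $ j * h $ j / \<mu> + t * (g \<bullet> h) * (p $ j * g $ j)" for j
      using \<beta>[of j, symmetric] \<mu> by (simp add: y algebra_simps)
    hence py: "p \<bullet> y = (g \<bullet> h) / \<mu> + t * (g \<bullet> h) * (p \<bullet> g)"
      by (simp add: inner_vec_def sum.distrib sum_distrib_left sum_divide_distrib)
    have "((diag \<alpha> + s *\<^sub>R outer p p) *v y) $ i = \<alpha> $ i * y $ i + s * (p \<bullet> y) * p $ i"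
      by (simp add: matrix_vector_mult_add_rdistrib scaleR_matrix_vector_assoc[symmetric]
          diag_mult_vec outer_mult_vec)
    also have "\<dots> = \<alpha> $ i * \<beta> $ i * h $ i + t * (g \<bullet> h) * (\<alpha> $ i * g $ i) + s * (p \<bullet> y) * p $ i"
      by (simp add: y algebra_simps)
    also have "\<dots> = h $ i + (\<mu> * t + s / \<mu> + s * t) * (g \<bullet> h) * p $ i"
      by (simp add: \<alpha> \<alpha>\<beta> py pg algebra_simps)
    finally show ?thesis
      by (simp add: st y_def)
  qed
  thus ?thesis
    by (simp add: matrix_eq matrix_vector_mul_assoc[symmetric] vec_eq_iff)
qed

section \<open>Gradients and Hessians from derivatives\<close>

lemma gradient_eqI:
  assumes "GDERIV F x :> D"
  shows "gradient F x = D"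
  unfolding gradient_def
proof (rule the_equality[of "\<lambda>D. GDERIV F x :> D"])
  fix E assume "GDERIV F x :> E"
  with assms have "(\<lambda>h. h \<bullet> E) = (\<lambda>h. h \<bullet> D)"
    unfolding gderiv_def by (rule has_derivative_unique[rotated])
  hence "(E - D) \<bullet> (E - D) = 0"
    by (metis inner_diff_right right_minus_eq)
  thus "E = D"
    by simp
qed fact

lemma jacobian_at_eqI:
  assumes "(g has_derivative (*v) M) (at x)"
  shows "jacobian_at g x = M"
  unfolding jacobian_at_def by (simp add: frechet_derivative_at[OF assms, symmetric])

text \<open>The gradient is only known on a neighbourhood of the point; this suffices because derivatives
  are local.\<close>
lemma hessian_eqI:
  assumes S: "open S" "x \<in> S"
    and F: "\<And>y. y \<in> S \<Longrightarrow> GDERIV F y :> G y"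
    and G: "(G has_derivative (*v) M) (at x)"
  shows "twice_differentiable_at F x" and "hessian F x = M"
proof -
  have grad: "(gradient F has_derivative (*v) M) (at x)"
    by (rule has_derivative_transform_within_open[OF G S]) (simp add: gradient_eqI[OF F])
  show "hessian F x = M"
    unfolding hessian_def by (rule jacobian_at_eqI[OF grad])
  have "\<forall>\<^sub>F y in nhds x. F differentiable (at y)"
    unfolding eventually_nhds using S F by (auto simp: gderiv_def intro: differentiableI)
  thus "twice_differentiable_at F x"
    unfolding twice_differentiable_at_def using grad by (auto intro: differentiableI)
qed

lemma has_derivative_cartI:
  fixes g :: "real^'m \<Rightarrow> real^'n"
  assumes "\<And>i. ((\<lambda>y. g y $ i) has_derivative (\<lambda>h. g' h $ i)) (at x)"
  shows "(g has_derivative g') (at x)"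
  using assms by (auto simp: has_derivative_componentwise_within[of g] Basis_vec_def inner_axis)

lemma open_positive_orthant: "open {y :: real^'n. \<forall>j. 0 < y $ j}"
proof -
  have "{y :: real^'n. \<forall>j. 0 < y $ j} = (\<Inter>j. {y. 0 < y $ j})"
    by auto
  thus ?thesis
    by (simp add: open_INT open_Collect_less continuous_intros)
qed

section \<open>Logarithms of power sums\<close>

definition power_sum :: "real^'n \<Rightarrow> real \<Rightarrow> real^'n \<Rightarrow> real" where
  "power_sum c e y = (\<Sum>j\<in>UNIV. c $ j * y $ j powr e)"

text \<open>The gradient of \<open>ln (power_sum c e y)\<close> divided by \<open>e\<close>. Its coordinates are
  \<open>\<gamma>\<^sub>j / y\<^sub>j\<close>, where \<open>\<gamma>\<^sub>j\<close> is the share of the \<open>j\<close>-th summand in the power sum.\<close>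
definition log_gradient :: "real^'n \<Rightarrow> real \<Rightarrow> real^'n \<Rightarrow> real^'n" where
  "log_gradient c e y = (\<chi> j. c $ j * y $ j powr (e - 1) / power_sum c e y)"

lemma power_sum_pos:
  assumes "\<forall>j. 0 \<le> c $ j" "\<exists>j. 0 < c $ j" "\<forall>j. 0 < c $ j \<longrightarrow> 0 < y $ j"
  shows "0 < power_sum c e y"
proof -
  obtain j where j: "0 < c $ j"
    using assms by blast
  show ?thesis
    unfolding power_sum_def
    by (rule sum_pos2[of _ j]) (use assms j in auto)
qed

lemma has_derivative_coordinate_powr:
  fixes y :: "real^'n"
  assumes "0 < y $ i"
  shows "((\<lambda>y. y $ i powr e) has_derivative (\<lambda>h. e * y $ i powr (e - 1) * h $ i)) (at y)"
  by (rule has_derivative_compose[OF bounded_linear_imp_has_derivative[OF bounded_linear_vec_nth]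
        has_real_derivative_powr[OF assms, unfolded has_field_derivative_def]])

lemma power_sum_has_derivative:
  assumes y: "\<forall>j. 0 < y $ j" and pos: "0 < power_sum c e y"
  shows "(power_sum c e has_derivative (\<lambda>h. e * power_sum c e y * (log_gradient c e y \<bullet> h))) (at y)"
proof -
  have "((\<lambda>y. \<Sum>j\<in>UNIV. c $ j * y $ j powr e) has_derivative
      (\<lambda>h. \<Sum>j\<in>UNIV. c $ j * (e * y $ j powr (e - 1) * h $ j))) (at y)"
    by (intro has_derivative_sum has_derivative_mult_right has_derivative_coordinate_powr)
      (use y in auto)
  moreover have "(\<Sum>j\<in>UNIV. c $ j * (e * y $ j powr (e - 1) * h $ j))
      = e * power_sum c e y * (log_gradient c e y \<bullet> h)" for h
    using pos unfolding log_gradient_def inner_vec_def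
    by (simp add: sum_distrib_left mult_ac)
  ultimately show ?thesis
    unfolding power_sum_def[abs_def] by simp
qed

lemma GDERIV_ln_power_sum:
  assumes y: "\<forall>j. 0 < y $ j" and pos: "0 < power_sum c e y"
  shows "GDERIV (\<lambda>y. K * ln (power_sum c e y) + C) y :> (K * e) *\<^sub>R log_gradient c e y"
proof -
  have "((\<lambda>y. K * ln (power_sum c e y) + C) has_derivative
     (\<lambda>h. K * (e * power_sum c e y * (log_gradient c e y \<bullet> h) * inverse (power_sum c e y)) + 0)) (at y)"
    using pos by (auto intro!: derivative_eq_intros power_sum_has_derivative[OF y pos] simp: divide_inverse)
  thus ?thesis
    unfolding gderiv_def using pos by (simp add: inner_commute field_simps)
qed

text \<open>By the quotient rule, differentiating the numerators gives the diagonal part, and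
  differentiating the common denominator gives the rank-one part. This is the source of the DR1
  structure of the primal Hessian, the dual Hessian and the Jacobian of the best response.\<close>
lemma log_gradient_has_derivative:
  assumes y: "\<forall>j. 0 < y $ j" and pos: "0 < power_sum c e y"
  defines "g \<equiv> log_gradient c e y"
  shows "(log_gradient c e has_derivative
    (*v) (diag (\<chi> j. (e - 1) * g $ j / y $ j) - e *\<^sub>R outer g g)) (at y)"
proof (rule has_derivative_cartI)
  fix i
  define S where "S = power_sum c e y"
  have S: "0 < S" using pos by (simp add: S_def)
  have yi: "0 < y $ i" using y by blast
  have gi: "g $ i = c $ i * y $ i powr (e - 1) / S"
    by (simp add: g_def log_gradient_def S_def)
  have pw: "y $ i powr (e - 2) = y $ i powr (e - 1) / y $ i"
    using yi powr_diff[of "y $ i" "e - 1" 1] by simp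
  have "((\<lambda>y. c $ i * y $ i powr (e - 1) / power_sum c e y) has_derivative
     (\<lambda>h. (c $ i * ((e - 1) * y $ i powr (e - 1 - 1) * h $ i) * S
        - c $ i * y $ i powr (e - 1) * (e * S * (g \<bullet> h))) / (S * S))) (at y)"
    unfolding S_def g_def
    by (intro has_derivative_divide' has_derivative_mult_right has_derivative_coordinate_powr
        power_sum_has_derivative) (use y pos in auto)
  moreover have "(c $ i * ((e - 1) * y $ i powr (e - 1 - 1) * h $ i) * S
        - c $ i * y $ i powr (e - 1) * (e * S * (g \<bullet> h))) / (S * S)
     = ((diag (\<chi> j. (e - 1) * g $ j / y $ j) - e *\<^sub>R outer g g) *v h) $ i" for h
    using S yi
    by (simp add: matrix_vector_mult_diff_rdistrib scaleR_matrix_vector_assoc[symmetric]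
        outer_mult_vec diag_mult_vec gi pw field_simps)
  ultimately show "((\<lambda>y. log_gradient c e y $ i) has_derivative
     (\<lambda>h. ((diag (\<chi> j. (e - 1) * g $ j / y $ j) - e *\<^sub>R outer g g) *v h) $ i)) (at y)"
    by (simp add: log_gradient_def)
qed

text \<open>Both the negative log-utility and the optimal value have the form treated here, with different
  exponents \<open>e\<close>; the additive constant \<open>C\<close> absorbs the budget.\<close>
lemma hessian_ln_power_sum:
  assumes c: "\<forall>j. 0 \<le> c $ j" "\<exists>j. 0 < c $ j" and y: "\<forall>j. 0 < y $ j"
    and F: "\<And>z. \<forall>j. 0 < z $ j \<Longrightarrow> F z = K * ln (power_sum c e z) + C"
  defines "g \<equiv> log_gradient c e y"
  shows "twice_differentiable_at F y"
    and "hessian F y = (K * e) *\<^sub>R (diag (\<chi> j. (e - 1) * g $ j / y $ j) - e *\<^sub>R outer g g)"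
proof -
  let ?M = "diag (\<chi> j. (e - 1) * g $ j / y $ j) - e *\<^sub>R outer g g"
  let ?S = "{y :: real^'a. \<forall>j. 0 < y $ j}"
  have pos: "0 < power_sum c e z" if "z \<in> ?S" for z
    using c that by (intro power_sum_pos) auto
  have grad: "GDERIV F z :> (K * e) *\<^sub>R log_gradient c e z" if z: "z \<in> ?S" for z
    using GDERIV_ln_power_sum[of z c e K C] pos[OF z] z unfolding gderiv_def
    by (auto intro: has_derivative_transform_within_open[OF _ open_positive_orthant z] simp: F)
  have "((\<lambda>z. (K * e) *\<^sub>R log_gradient c e z) has_derivative (\<lambda>h. (K * e) *\<^sub>R (?M *v h))) (at y)"
    using log_gradient_has_derivative[OF y pos] y unfolding g_def
    by (intro has_derivative_scaleR_right) auto
  hence "((\<lambda>z. (K * e) *\<^sub>R log_gradient c e z) has_derivative (*v) ((K * e) *\<^sub>R ?M)) (at y)"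
    by (simp only: scaleR_matrix_vector_assoc)
  note H = hessian_eqI[OF open_positive_orthant _ grad this]
  show "twice_differentiable_at F y" "hessian F y = (K * e) *\<^sub>R ?M"
    using H y by auto
qed

section \<open>Homogeneous components\<close>

text \<open>The tangent line inequality for \<open>t\<^sup>r / r\<close>. Dividing by \<open>r\<close> makes the function strictly concave
  for both signs of \<open>r\<close>, so that maximisation (\<open>r > 0\<close>) and minimisation (\<open>r < 0\<close>) of a
  power sum are one problem. For \<open>r < 0\<close> the point \<open>t = 0\<close> has to be excluded, since the true value
  there is infinite whereas \<open>0 powr r = 0\<close>.\<close>

lemma powr_scaled_strict_concave:
  fixes r s t :: real
  assumes r: "r < 1" "r \<noteq> 0" and s: "0 < s" and t: "0 \<le> t" "r < 0 \<Longrightarrow> 0 < t" and "t \<noteq> s"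
  shows "t powr r / r < s powr r / r + s powr (r - 1) * (t - s)"
proof (cases "t = 0")
  case True
  with t r have "0 < r" by force
  moreover have "s powr (r - 1) * s = s powr r"
    using s powr_add[of s "r - 1" 1] by simp
  moreover have "0 < s powr r" using s by simp
  ultimately show ?thesis
    using True r by (simp add: field_simps)
next
  case False
  with t have t: "0 < t" by simp
  have deriv: "((\<lambda>z. z powr r / r) has_real_derivative z powr (r - 1)) (at z)" if "0 < z" for z
    using has_real_derivative_powr[OF that, of r] r
    by (auto intro!: derivative_eq_intros that)
  have less: "z powr (r - 1) < y powr (r - 1)" if "0 < y" "y < z" for y z :: real
    using that r by (intro powr_less_mono2_neg) auto
  \<comment> \<open>By the mean value theorem the secant slope is \<open>z\<^sup>r\<^sup>-\<^sup>1\<close> for some intermediate \<open>z\<close>, and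
    \<open>z\<^sup>r\<^sup>-\<^sup>1\<close> is strictly decreasing in \<open>z\<close>.\<close>
  consider "t < s" | "s < t" using \<open>t \<noteq> s\<close> by linarith
  thus ?thesis
  proof cases
    case 1
    obtain z where z: "t < z" "z < s" "s powr r / r - t powr r / r = (s - t) * z powr (r - 1)"
      using MVT2[OF 1, of "\<lambda>z. z powr r / r" "\<lambda>z. z powr (r - 1)"] deriv t by auto
    have "(s - t) * s powr (r - 1) < (s - t) * z powr (r - 1)"
      using less[of z s] z t 1 by simp
    with z show ?thesis by (simp add: algebra_simps)
  next
    case 2
    obtain z where z: "s < z" "z < t" "t powr r / r - s powr r / r = (t - s) * z powr (r - 1)"
      using MVT2[OF 2, of "\<lambda>z. z powr r / r" "\<lambda>z. z powr (r - 1)"] deriv s by auto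
    have "(t - s) * z powr (r - 1) < (t - s) * s powr (r - 1)"
      using less[of s z] z s 2 by simp
    with z show ?thesis by (simp add: algebra_simps)
  qed
qed

text \<open>Homogeneity determines the component on the open half-line by its value at 1, and continuity
  then forces the value at 0, which is infinite exactly when \<open>r\<close> is negative and the component does
  not vanish.\<close>
lemma homogeneous_component_eq:
  assumes \<theta>: "homogeneous_component r \<theta>" and r: "r \<noteq> 0" and t: "0 \<le> t"
  defines "a \<equiv> enn2real (\<theta> 1)"
  shows "\<theta> t = (if r < 0 \<and> t = 0 \<and> 0 < a then \<infinity> else ennreal (a * t powr r))"
proof -
  have a: "\<theta> 1 = ennreal a"
    using \<theta> by (simp add: a_def homogeneous_component_def)
  have a0: "0 \<le> a" by (simp add: a_def)
  have pos: "\<theta> s = ennreal (a * s powr r)" if "0 < s" for s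
  proof -
    have "\<theta> (s * 1) = ennreal (s powr r) * \<theta> 1"
      using \<theta> that unfolding homogeneous_component_def by (meson zero_le_one)
    thus ?thesis by (simp add: a ennreal_mult a0 mult.commute)
  qed
  have "(\<theta> \<longlongrightarrow> \<theta> 0) (at 0 within {0..})"
    using \<theta> by (auto simp: homogeneous_component_def continuous_on_def)
  hence "(\<theta> \<longlongrightarrow> \<theta> 0) (at_right 0)"
    by (rule tendsto_within_subset) auto
  hence lim: "((\<lambda>s. ennreal (a * s powr r)) \<longlongrightarrow> \<theta> 0) (at_right 0)"
    by (rule Lim_transform_eventually) (auto simp: eventually_at_filter pos)
  have "\<theta> 0 = (if r < 0 \<and> 0 < a then \<infinity> else 0)"
  proof (cases "a = 0")
    case True
    with lim show ?thesis by (simp add: tendsto_const_iff)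
  next
    case False
    with a0 have a1: "0 < a" by simp
    show ?thesis
    proof (cases "0 < r")
      case True
      have "((\<lambda>s. a * s powr r) \<longlongrightarrow> 0) (at_right 0)"
        using True by real_asymp
      hence "((\<lambda>s. ennreal (a * s powr r)) \<longlongrightarrow> ennreal 0) (at_right 0)"
        by (rule tendsto_ennrealI)
      from tendsto_unique[OF _ lim this] True show ?thesis by simp
    next
      case False
      with r have "r < 0" by simp
      hence "filterlim (\<lambda>s. a * s powr r) at_top (at_right 0)"
        using a1 by real_asymp
      hence "((\<lambda>s. ennreal (a * s powr r)) \<longlongrightarrow> top) (at_right 0)"
        by (simp add: ennreal_tendsto_top_eq_at_top)
      from tendsto_unique[OF _ lim this] \<open>r < 0\<close> a1 show ?thesis by simp
    qed
  qed
  with pos t show ?thesis by (cases "t = 0") auto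
qed

text \<open>If all components vanished, the utility would be constant on the orthant, with value 0 or
  \<open>\<infinity>\<close>.\<close>
lemma in_class_A_coefficients:
  assumes "in_class_A k r \<theta> u" and proper: "\<exists>y\<in>orthant. 0 < u y \<and> u y < \<infinity>"
  shows "\<exists>j. 0 < enn2real (\<theta> j 1)"
proof (rule ccontr)
  assume none: "\<nexists>j. 0 < enn2real (\<theta> j 1)"
  obtain y where y: "y \<in> orthant" "0 < u y" "u y < \<infinity>"
    using proper by blast
  have "\<theta> j (y $ j) = 0" for j
  proof -
    have "enn2real (\<theta> j 1) = 0"
      using none by (metis enn2real_nonneg less_eq_real_def)
    moreover have "homogeneous_component r (\<theta> j)" "r \<noteq> 0" "0 \<le> y $ j"
      using assms y by (auto simp: in_class_A_def orthant_def)
    ultimately show ?thesis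
      by (subst homogeneous_component_eq) simp_all
  qed
  hence "u y = epowr 0 k"
    using assms y by (simp add: in_class_A_def)
  thus False
    using y by (auto simp: epowr_def split: if_splits)
qed

section \<open>Demand of a consumer with constant elasticity of substitution\<close>

text \<open>A consumer with budget \<open>w\<close> whose utility is a monotone function of
  \<open>(\<Sum>\<^sub>j a\<^sub>j x\<^sub>j\<^sup>r) / r\<close>.\<close>

locale ces_consumer =
  fixes r w :: real and a :: "real^'n"
  assumes r: "r < 1" "r \<noteq> 0" and w: "0 < w"
    and a_nonneg: "0 \<le> a $ j" and a_nonzero: "\<exists>j. 0 < a $ j"
begin

text \<open>The dual of a power sum with exponent \<open>r\<close> and weights \<open>a\<close> is again a power sum: with
  \<open>s = 1 / (1 - r)\<close> its weights are \<open>a\<^sub>j\<^sup>s\<close> and its exponent is \<open>1 - s = - r / (1 - r)\<close>.\<close>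
definition dual_weights :: "real^'n" where
  "dual_weights = (\<chi> j. a $ j powr (1 / (1 - r)))"

definition price_sum :: "real^'n \<Rightarrow> real" where
  "price_sum q = power_sum dual_weights (- r / (1 - r)) q"

text \<open>Up to the normalisation by the budget, the demand is the logarithmic gradient of the dual power
  sum. Writing the first-order solution in this form makes its Jacobian, and its relation to the
  gradient of the optimal value, instances of the calculus of power sums.\<close>
definition demand :: "real^'n \<Rightarrow> real^'n" where
  "demand q = w *\<^sub>R log_gradient dual_weights (- r / (1 - r)) q"

text \<open>The Lagrange multiplier of the budget constraint for the objective
  \<open>(\<Sum>\<^sub>j a\<^sub>j x\<^sub>j\<^sup>r) / r\<close>.\<close>
definition multiplier :: "real^'n \<Rightarrow> real" where
  "multiplier q = (w / price_sum q) powr (r - 1)"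

text \<open>On the orthant, this says that no component is infinite. At such points the extended-valued
  sum of the components agrees with the real power sum.\<close>
definition finite_at :: "real^'n \<Rightarrow> bool" where
  "finite_at y \<longleftrightarrow> (r < 0 \<longrightarrow> (\<forall>j. 0 < a $ j \<longrightarrow> 0 < y $ j))"

lemma dual_weights_nonneg: "\<forall>j. 0 \<le> dual_weights $ j"
  by (simp add: dual_weights_def)

lemma dual_weights_nonzero: "\<exists>j. 0 < dual_weights $ j"
proof -
  obtain j where "0 < a $ j"
    using a_nonzero by blast
  hence "0 < dual_weights $ j"
    by (simp add: dual_weights_def)
  thus ?thesis ..
qed

context
  fixes q :: "real^'n"
  assumes q: "\<forall>j. 0 < q $ j"
begin

lemma price_sum_pos: "0 < price_sum q"
  unfolding price_sum_def using dual_weights_nonneg dual_weights_nonzero q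
  by (intro power_sum_pos) auto

lemma multiplier_pos: "0 < multiplier q"
  using price_sum_pos w by (simp add: multiplier_def)

lemma demand_nth: "demand q $ j = w / price_sum q * (a $ j / q $ j) powr (1 / (1 - r))"
proof -
  have "- r / (1 - r) - 1 = - (1 / (1 - r))"
    using r by (simp add: field_simps)
  thus ?thesis
    using q a_nonneg[of j]
    by (simp add: demand_def log_gradient_def dual_weights_def price_sum_def powr_divide powr_minus
        divide_inverse[of "w * _"] divide_inverse[of "a $ j powr _"] less_imp_le mult_ac)
qed

lemma demand_nonneg: "0 \<le> demand q $ j"
  and demand_pos_iff: "0 < demand q $ j \<longleftrightarrow> 0 < a $ j"
  using price_sum_pos w q a_nonneg[of j] by (auto simp: demand_nth zero_less_mult_iff less_le)

lemma demand_finite: "finite_at (demand q)"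
  by (simp add: finite_at_def demand_pos_iff)

lemma demand_spends_budget: "q \<bullet> demand q = w"
proof -
  have "q $ j * demand q $ j = w / price_sum q * (dual_weights $ j * q $ j powr (- r / (1 - r)))" for j
  proof -
    have "q $ j * q $ j powr (- r / (1 - r) - 1) = q $ j powr (- r / (1 - r))"
      using q powr_add[of "q $ j" 1 "- r / (1 - r) - 1"] by (simp add: less_imp_le)
    thus ?thesis
      by (simp add: demand_def log_gradient_def price_sum_def)
  qed
  hence "q \<bullet> demand q = w / price_sum q * price_sum q"
    unfolding price_sum_def[of q] power_sum_def by (simp only: inner_vec_def inner_real_def sum_distrib_left)
  thus ?thesis
    using price_sum_pos by simp
qed

lemma demand_first_order:
  assumes "0 < a $ j"
  shows "a $ j * demand q $ j powr (r - 1) = multiplier q * q $ j"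
proof -
  have "1 / (1 - r) * (r - 1) = - 1"
    using r by (simp add: field_simps)
  hence "demand q $ j powr (r - 1) = multiplier q * (a $ j / q $ j) powr (- 1)"
    using price_sum_pos w q assms unfolding demand_nth multiplier_def
    by (subst powr_mult) (simp_all only: powr_powr)
  also have "(a $ j / q $ j) powr (- 1) = q $ j / a $ j"
    using q assms by (simp add: powr_minus less_imp_le)
  finally show ?thesis
    using assms by simp
qed

text \<open>At the optimum the contribution of each good to the power sum is proportional to the money
  spent on it; hence the shares are the fractions of the budget.\<close>
lemma demand_value: "a $ j * demand q $ j powr r = multiplier q * (q $ j * demand q $ j)"
proof (cases "0 < a $ j")
  case True
  hence "0 < demand q $ j" by (simp add: demand_pos_iff)
  hence "demand q $ j powr r = demand q $ j powr (r - 1) * demand q $ j"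
    using powr_add[of "demand q $ j" "r - 1" 1] by simp
  thus ?thesis
    using demand_first_order[OF True] by simp
next
  case False
  hence "a $ j = 0" using a_nonneg[of j] by simp
  thus ?thesis by (simp add: demand_nth)
qed

lemma power_sum_demand: "power_sum a r (demand q) = multiplier q * w"
  by (simp add: power_sum_def demand_value sum_distrib_left[symmetric]
      demand_spends_budget[unfolded inner_vec_def, simplified])

lemma ln_power_sum_demand:
  "ln (power_sum a r (demand q)) = (1 - r) * ln (price_sum q) + r * ln w"
  using price_sum_pos w
  by (simp add: power_sum_demand multiplier_def ln_mult ln_powr ln_div algebra_simps)

lemma demand_in_budget: "demand q \<in> budget_set w q"
  by (simp add: budget_set_def orthant_def demand_nonneg demand_spends_budget)

text \<open>Each summand lies below its tangent at the demand, and by the first-order condition all these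
  tangents have slope \<open>multiplier q\<close> times the price. Summing up, the linear terms amount to the
  multiplier times the difference of expenditures, which is not positive because the demand spends
  the whole budget. For a good of weight 0 the tangent inequality is replaced by the fact that
  buying it costs money and yields nothing. Strictness in one coordinate gives uniqueness.\<close>
lemma demand_optimal:
  assumes y: "y \<in> budget_set w q" "finite_at y" and neq: "y \<noteq> demand q"
  shows "power_sum a r y / r < power_sum a r (demand q) / r"
proof -
  let ?x = "demand q" and ?m = "multiplier q"
  have y0: "0 \<le> y $ j" for j
    using y by (simp add: budget_set_def orthant_def)
  have strict: "a $ j * y $ j powr r / r < a $ j * ?x $ j powr r / r + ?m * (q $ j * (y $ j - ?x $ j))"
    if "y $ j \<noteq> ?x $ j" for j
  proof (cases "0 < a $ j")
    case True
    have "y $ j powr r / r < ?x $ j powr r / r + ?x $ j powr (r - 1) * (y $ j - ?x $ j)"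
      using True y y0 that r by (intro powr_scaled_strict_concave) (auto simp: demand_pos_iff finite_at_def)
    hence "a $ j * (y $ j powr r / r)
        < a $ j * (?x $ j powr r / r + ?x $ j powr (r - 1) * (y $ j - ?x $ j))"
      using True by (rule mult_strict_left_mono)
    also have "\<dots> = a $ j * ?x $ j powr r / r + (a $ j * ?x $ j powr (r - 1)) * (y $ j - ?x $ j)"
      by (simp add: algebra_simps)
    finally show ?thesis
      by (simp add: demand_first_order[OF True] mult_ac)
  next
    case False
    hence a0: "a $ j = 0" using a_nonneg[of j] by simp
    hence "?x $ j = 0" by (simp add: demand_nth)
    with that y0[of j] multiplier_pos q a0 show ?thesis by simp
  qed
  have weak: "a $ j * y $ j powr r / r \<le> a $ j * ?x $ j powr r / r + ?m * (q $ j * (y $ j - ?x $ j))" for j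
    using strict[of j] by (cases "y $ j = ?x $ j") auto
  obtain i where i: "y $ i \<noteq> ?x $ i"
    using neq by (auto simp: vec_eq_iff)
  have "(\<Sum>j\<in>UNIV. a $ j * y $ j powr r / r)
      < (\<Sum>j\<in>UNIV. a $ j * ?x $ j powr r / r + ?m * (q $ j * (y $ j - ?x $ j)))"
    using weak strict[OF i] by (intro sum_strict_mono_ex1) auto
  also have "\<dots> = power_sum a r ?x / r + ?m * (q \<bullet> y - q \<bullet> ?x)"
    by (simp add: power_sum_def sum.distrib sum_divide_distrib sum_distrib_left[symmetric]
        inner_vec_def right_diff_distrib sum_subtractf)
  also have "\<dots> \<le> power_sum a r ?x / r"
    using y multiplier_pos
    by (simp add: demand_spends_budget budget_set_def mult_le_0_iff)
  finally show ?thesis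
    by (simp add: power_sum_def sum_divide_distrib)
qed

end

lemma finite_at_power_sum_pos:
  assumes "y \<in> orthant" "finite_at y" "r < 0"
  shows "0 < power_sum a r y"
  using assms a_nonneg a_nonzero by (intro power_sum_pos) (auto simp: finite_at_def)

text \<open>This is \<open>P\<^sup>-\<^sup>1 (\<Gamma> - r \<gamma> \<gamma>\<^sup>T) P\<^sup>-\<^sup>1\<close> at the prices \<open>q\<close>, written in terms of
  \<open>\<gamma>\<^sub>j / q\<^sub>j = x\<^sub>j / w\<close>.\<close>
abbreviation substitution_matrix :: "real^'n \<Rightarrow> real^'n^'n" where
  "substitution_matrix q \<equiv> diag (\<chi> j. demand q $ j / (w * q $ j))
     - r *\<^sub>R outer ((1 / w) *\<^sub>R demand q) ((1 / w) *\<^sub>R demand q)"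

lemma log_gradient_price_sum:
  "log_gradient dual_weights (- r / (1 - r)) q = (1 / w) *\<^sub>R demand q"
  using w by (simp add: demand_def)

lemma jacobian_log_gradient_price_sum:
  fixes q :: "real^'n"
  defines "e \<equiv> - r / (1 - r)" and "g \<equiv> (1 / w) *\<^sub>R demand q"
  shows "diag (\<chi> j. (e - 1) * g $ j / q $ j) - e *\<^sub>R outer g g
    = - (1 / (1 - r)) *\<^sub>R substitution_matrix q"
proof -
  define t where "t = 1 / (1 - r)"
  have e: "e = - r * t" "e - 1 = - t"
    using r by (auto simp: t_def e_def field_simps)
  show ?thesis
    unfolding e(2) t_def[symmetric] g_def unfolding e(1) by (simp add: vec_eq_iff diag_nth outer_nth algebra_simps)
qed

lemma demand_has_derivative:
  assumes q: "\<forall>j. 0 < q $ j"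
  shows "(demand has_derivative (*v) (- (w / (1 - r)) *\<^sub>R substitution_matrix q)) (at q)"
proof -
  let ?e = "- r / (1 - r)"
  have "(log_gradient dual_weights ?e has_derivative
      (*v) (- (1 / (1 - r)) *\<^sub>R substitution_matrix q)) (at q)"
    using log_gradient_has_derivative[OF q, of dual_weights ?e] price_sum_pos[OF q]
    by (simp only: log_gradient_price_sum jacobian_log_gradient_price_sum price_sum_def)
  hence "((\<lambda>q. w *\<^sub>R log_gradient dual_weights ?e q) has_derivative
      (\<lambda>h. w *\<^sub>R ((- (1 / (1 - r)) *\<^sub>R substitution_matrix q) *v h))) (at q)"
    by (rule has_derivative_scaleR_right)
  thus ?thesis
    unfolding demand_def[abs_def, symmetric] by (simp add: scaleR_matrix_vector_assoc)
qed

text \<open>By the formula for the optimal power sum, the optimal value is \<open>k (1 - r)\<close> times the logarithm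
  of the dual power sum, up to a constant.\<close>
lemma dual_hessian:
  assumes q: "\<forall>j. 0 < q $ j"
    and F: "\<And>z. \<forall>j. 0 < z $ j \<Longrightarrow> F z = k * ln (power_sum a r (demand z))"
  shows "twice_differentiable_at F q"
    and "hessian F q = (k * r / (1 - r)) *\<^sub>R substitution_matrix q"
proof -
  let ?e = "- r / (1 - r)"
  have F': "F z = (k * (1 - r)) * ln (power_sum dual_weights ?e z) + k * r * ln w"
    if "\<forall>j. 0 < z $ j" for z
    using F[OF that] by (simp add: ln_power_sum_demand[OF that] price_sum_def algebra_simps)
  note H = hessian_ln_power_sum[OF dual_weights_nonneg dual_weights_nonzero q F']
  show "twice_differentiable_at F q"
    by (rule H(1))
  let ?g = "(1 / w) *\<^sub>R demand q"
  have "hessian F q = (k * (1 - r) * ?e) *\<^sub>R (diag (\<chi> j. (?e - 1) * ?g $ j / q $ j) - ?e *\<^sub>R outer ?g ?g)"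
    unfolding log_gradient_price_sum[symmetric] by (rule H(2))
  hence "hessian F q = (k * (1 - r) * ?e) *\<^sub>R (- (1 / (1 - r)) *\<^sub>R substitution_matrix q)"
    by (simp only: jacobian_log_gradient_price_sum)
  moreover have "k * (1 - r) * ?e * (- (1 / (1 - r))) = k * r / (1 - r)"
    using r by simp
  ultimately show "hessian F q = (k * r / (1 - r)) *\<^sub>R substitution_matrix q"
    by (simp only: scaleR_scaleR)
qed

text \<open>By the first-order condition the logarithmic gradient of the power sum at the demand is
  \<open>q / w\<close>, so the rank-one part of the Hessian is a multiple of \<open>outer q q\<close>.\<close>
lemma primal_hessian:
  assumes q: "\<forall>j. 0 < q $ j" and a: "\<forall>j. 0 < a $ j"
    and F: "\<And>z. \<forall>j. 0 < z $ j \<Longrightarrow> F z = - k * ln (power_sum a r z)"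
  shows "twice_differentiable_at F (demand q)"
    and "hessian F (demand q) = diag (\<chi> j. k * r * (1 - r) * q $ j / (w * demand q $ j))
           + (k * r * r / w\<^sup>2) *\<^sub>R outer q q"
proof -
  have x: "\<forall>j. 0 < demand q $ j"
    using a by (simp add: demand_pos_iff[OF q])
  have g: "log_gradient a r (demand q) = (1 / w) *\<^sub>R q"
    using a multiplier_pos[OF q] w
    by (simp add: vec_eq_iff log_gradient_def demand_first_order[OF q] power_sum_demand[OF q])
  have F': "F z = - k * ln (power_sum a r z) + 0" if "\<forall>j. 0 < z $ j" for z
    using F[OF that] by simp
  have a': "\<forall>j. 0 \<le> a $ j" by (simp add: a_nonneg)
  note H = hessian_ln_power_sum[OF a' a_nonzero x F']
  show "twice_differentiable_at F (demand q)"
    by (rule H(1))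
  have "hessian F (demand q) = (- k * r) *\<^sub>R (diag (\<chi> j. (r - 1) * ((1 / w) *\<^sub>R q) $ j / demand q $ j)
      - r *\<^sub>R outer ((1 / w) *\<^sub>R q) ((1 / w) *\<^sub>R q))"
    unfolding g[symmetric] by (rule H(2))
  also have "\<dots> = diag (\<chi> j. k * r * (1 - r) * q $ j / (w * demand q $ j))
           + (k * r * r / w\<^sup>2) *\<^sub>R outer q q"
    by (simp add: vec_eq_iff diag_nth outer_nth power2_eq_square left_diff_distrib right_diff_distrib
        diff_divide_distrib mult_ac)
  finally show "hessian F (demand q) = diag (\<chi> j. k * r * (1 - r) * q $ j / (w * demand q $ j))
           + (k * r * r / w\<^sup>2) *\<^sub>R outer q q" .
qed

section \<open>The best response and the optimal value\<close>

lemma sum_components_eq: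
  assumes \<theta>: "\<And>j. homogeneous_component r (\<theta> j)" and a: "a = (\<chi> j. enn2real (\<theta> j 1))"
    and y: "y \<in> orthant"
  shows "(\<Sum>j\<in>UNIV. \<theta> j (y $ j)) = (if finite_at y then ennreal (power_sum a r y) else \<infinity>)"
proof -
  have \<theta>_eq: "\<theta> j (y $ j) =
      (if r < 0 \<and> y $ j = 0 \<and> 0 < a $ j then \<infinity> else ennreal (a $ j * y $ j powr r))" for j
    using homogeneous_component_eq[OF \<theta> r(2), of "y $ j" j] y by (simp add: a orthant_def)
  show ?thesis
  proof (cases "finite_at y")
    case True
    hence "\<theta> j (y $ j) = ennreal (a $ j * y $ j powr r)" for j
      unfolding \<theta>_eq by (auto simp: finite_at_def)
    thus ?thesis
      using True a_nonneg by (simp add: power_sum_def sum_ennreal)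
  next
    case False
    then obtain j where "r < 0" "0 < a $ j" "y $ j = 0"
      using y by (force simp: finite_at_def orthant_def less_eq_real_def)
    hence "\<theta> j (y $ j) = \<infinity>"
      by (subst \<theta>_eq) simp
    hence "(\<Sum>j\<in>UNIV. \<theta> j (y $ j)) = \<infinity>"
      by (auto simp: ennreal_sum_eq_top)
    with False show ?thesis by simp
  qed
qed

text \<open>The signs of \<open>k\<close> and \<open>r\<close> agree. Therefore the two degenerate cases, an infinite sum for
  \<open>r < 0\<close> and a vanishing sum for \<open>r > 0\<close>, both mean utility 0.\<close>
lemma log_utility_eq:
  assumes u: "in_class_A k r \<theta> u" and a: "a = (\<chi> j. enn2real (\<theta> j 1))"
    and y: "y \<in> orthant"
  shows "elog (u y) = (if finite_at y \<and> 0 < power_sum a r y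
    then ereal (k * ln (power_sum a r y)) else -\<infinity>)"
proof -
  have sgn: "0 < k \<longleftrightarrow> 0 < r"
    using u by (auto simp: in_class_A_def zero_less_mult_iff)
  have \<theta>: "homogeneous_component r (\<theta> j)" for j
    using u by (simp add: in_class_A_def)
  have u_eq: "u y = epowr (if finite_at y then ennreal (power_sum a r y) else \<infinity>) k"
    using u y sum_components_eq[OF \<theta> a y] by (simp add: in_class_A_def)
  have nonneg: "0 \<le> power_sum a r y"
    unfolding power_sum_def using a_nonneg by (simp add: sum_nonneg)
  consider "\<not> finite_at y" | "finite_at y" "power_sum a r y = 0" | "finite_at y" "0 < power_sum a r y"
    using nonneg by linarith
  thus ?thesis
  proof cases
    case 1
    hence "r < 0" by (auto simp: finite_at_def)
    with 1 sgn show ?thesis by (simp add: u_eq epowr_def elog_def)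
  next
    case 2
    hence "0 < r" using finite_at_power_sum_pos[OF y] r by force
    with 2 sgn show ?thesis by (simp add: u_eq epowr_def elog_def)
  next
    case 3
    thus ?thesis
      by (simp add: u_eq epowr_def elog_def ln_powr ennreal_eq_0_iff)
  qed
qed

text \<open>Since \<open>k * r > 0\<close>, the log-utility \<open>k * ln S\<close> is increasing in \<open>S / r\<close> for either sign of
  \<open>r\<close>.\<close>
lemma log_utility_less:
  assumes u: "in_class_A k r \<theta> u" and a: "a = (\<chi> j. enn2real (\<theta> j 1))"
    and q: "\<forall>j. 0 < q $ j" and y: "y \<in> budget_set w q" "y \<noteq> demand q"
  shows "elog (u y) < elog (u (demand q))"
proof -
  let ?x = "demand q"
  have orth: "y \<in> orthant" "?x \<in> orthant"
    using y demand_in_budget[OF q] by (auto simp: budget_set_def)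
  have pos: "0 < power_sum a r ?x"
    using multiplier_pos[OF q] w by (simp add: power_sum_demand[OF q])
  hence ux: "elog (u ?x) = ereal (k * ln (power_sum a r ?x))"
    using log_utility_eq[OF u a orth(2)] demand_finite[OF q] by simp
  show ?thesis
  proof (cases "finite_at y \<and> 0 < power_sum a r y")
    case True
    hence less: "power_sum a r y / r < power_sum a r ?x / r"
      using demand_optimal[OF q y(1) _ y(2)] by blast
    have kr: "0 < k * r" using u by (simp add: in_class_A_def)
    have "k * ln (power_sum a r y) < k * ln (power_sum a r ?x)"
    proof (cases "0 < r")
      case True': True
      with less kr True pos show ?thesis
        by (simp add: divide_less_cancel zero_less_mult_iff)
    next
      case False
      with less kr True pos r show ?thesis
        by (auto simp: divide_less_cancel zero_less_mult_iff mult_less_cancel_left)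
    qed
    thus ?thesis
      using True by (simp add: ux log_utility_eq[OF u a orth(1)])
  next
    case False
    thus ?thesis by (simp only: ux log_utility_eq[OF u a orth(1)] if_False) simp
  qed
qed

lemma best_response_eq_demand:
  assumes u: "in_class_A k r \<theta> u" and a: "a = (\<chi> j. enn2real (\<theta> j 1))"
    and q: "\<forall>j. 0 < q $ j"
  shows "best_response (\<lambda>y. - elog (u y)) w q = demand q"
  unfolding best_response_def
proof (rule the_equality)
  show "demand q \<in> budget_set w q \<and> (\<forall>y\<in>budget_set w q. - (- elog (u y)) \<le> - (- elog (u (demand q))))"
    using demand_in_budget[OF q] log_utility_less[OF u a q] by (metis ereal_uminus_uminus order.refl less_imp_le)
next
  fix z
  assume z: "z \<in> budget_set w q \<and> (\<forall>y\<in>budget_set w q. - (- elog (u y)) \<le> - (- elog (u z)))"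
  hence "elog (u (demand q)) \<le> elog (u z)"
    using demand_in_budget[OF q] by simp
  thus "z = demand q"
    using log_utility_less[OF u a q] z by (metis leD)
qed

lemma opt_value_eq:
  assumes u: "in_class_A k r \<theta> u" and a: "a = (\<chi> j. enn2real (\<theta> j 1))"
    and q: "\<forall>j. 0 < q $ j"
  shows "opt_value (\<lambda>y. - elog (u y)) w q = ereal (k * ln (power_sum a r (demand q)))"
proof -
  have pos: "0 < power_sum a r (demand q)"
    using multiplier_pos[OF q] w by (simp add: power_sum_demand[OF q])
  have orth: "demand q \<in> orthant"
    using demand_in_budget[OF q] by (simp add: budget_set_def)
  have "(SUP y\<in>budget_set w q. - (- elog (u y))) = elog (u (demand q))"
  proof (rule SUP_eqI)
    show "- (- elog (u y)) \<le> elog (u (demand q))" if "y \<in> budget_set w q" for y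
      using log_utility_less[OF u a q that] by (cases "y = demand q") auto
    show "elog (u (demand q)) \<le> z"
      if "\<And>y. y \<in> budget_set w q \<Longrightarrow> - (- elog (u y)) \<le> z" for z
      using that[OF demand_in_budget[OF q]] by simp
  qed
  thus ?thesis
    using log_utility_eq[OF u a orth] demand_finite[OF q] pos by (simp add: opt_value_def)
qed

lemma shares_demand:
  assumes \<theta>: "\<And>j. homogeneous_component r (\<theta> j)" and a: "a = (\<chi> j. enn2real (\<theta> j 1))"
    and q: "\<forall>j. 0 < q $ j"
  shows "shares \<theta> (demand q) = (\<chi> j. q $ j * demand q $ j / w)"
proof -
  have fin: "finite_at (demand q)" by (rule demand_finite[OF q])
  have orth: "demand q \<in> orthant"
    using demand_in_budget[OF q] by (simp add: budget_set_def)
  have m: "0 < multiplier q" by (rule multiplier_pos[OF q])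
  have S: "(\<Sum>l\<in>UNIV. \<theta> l (demand q $ l)) = ennreal (multiplier q * w)"
    using sum_components_eq[OF \<theta> a orth] fin by (simp add: power_sum_demand[OF q])
  have "\<theta> j (demand q $ j) = ennreal (multiplier q * (q $ j * demand q $ j))" for j
    using homogeneous_component_eq[OF \<theta> r(2), of "demand q $ j" j] demand_nonneg[OF q, of j] fin
    by (auto simp: a[THEN arg_cong[where f = "\<lambda>v. v $ j"], simplified, symmetric]
        finite_at_def demand_value[OF q])
  thus ?thesis
    using m w q demand_nonneg[OF q]
    unfolding shares_def S by (simp add: vec_eq_iff less_imp_le)
qed

end

section \<open>The Hessians and the Jacobian at the best response\<close>

theorem lemma3p3:
  fixes k r d w :: real
    and \<theta> :: "'n::finite \<Rightarrow> real \<Rightarrow> ennreal"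
    and u :: "real^'n \<Rightarrow> ennreal"
    and v f :: "real^'n \<Rightarrow> ereal"
    and vr fr :: "real^'n \<Rightarrow> real"
    and x :: "real^'n \<Rightarrow> real^'n"
    and p \<gamma> :: "real^'n"
    and P X \<Gamma> :: "real^'n^'n"
  assumes u: "in_class_A k r \<theta> u"
    and u_proper: "\<exists>y\<in>orthant. 0 < u y \<and> u y < \<infinity>"
    and d: "d = k * r"
    and range: "(0 < r \<and> r < 1 \<and> 0 < k \<and> k \<le> 1 / r) \<or> (r < 0 \<and> 1 / r \<le> k \<and> k < 0)"
    and w: "0 < w"
    and p: "\<forall>j. 0 < p $ j"
    and v: "v = (\<lambda>y. - elog (u y))"
    and f: "f = opt_value v w"
    and x: "x = best_response v w"
    and vr: "vr = (\<lambda>y. real_of_ereal (v y))"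
    and fr: "fr = (\<lambda>q. real_of_ereal (f q))"
    and \<gamma>: "\<gamma> = shares \<theta> (x p)"
    and P: "P = diag p"
    and X: "X = diag (x p)"
    and \<Gamma>: "\<Gamma> = diag \<gamma>"
  shows "\<gamma> = (1 / w) *\<^sub>R (X *v p) \<and> \<gamma> \<in> unit_simplex
    \<and> ((\<forall>j. 0 < \<gamma> $ j) \<longrightarrow>
          twice_differentiable_at vr (x p)
        \<and> hessian vr (x p) = (d * (1 - r) / w\<^sup>2) *\<^sub>R (P ** matrix_inv \<Gamma> ** P)
                              + (d * r / w\<^sup>2) *\<^sub>R outer p p
        \<and> invertible (hessian vr (x p))
        \<and> hessian fr p = (d\<^sup>2 / w\<^sup>2) *\<^sub>R matrix_inv (hessian vr (x p))
        \<and> DR1 (hessian vr (x p)))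
    \<and> twice_differentiable_at fr p
    \<and> hessian fr p =
        (d / (1 - r)) *\<^sub>R (matrix_inv P ** (\<Gamma> - r *\<^sub>R outer \<gamma> \<gamma>) ** matrix_inv P)
    \<and> x differentiable (at p)
    \<and> jacobian_at x p = - ((w / d) *\<^sub>R hessian fr p)
    \<and> jacobian_at x p =
        - ((w / (1 - r)) *\<^sub>R (matrix_inv P ** (\<Gamma> - r *\<^sub>R outer \<gamma> \<gamma>) ** matrix_inv P))
    \<and> DR1 (hessian fr p)
    \<and> DR1 (jacobian_at x p)"
proof -
  define a where "a = (\<chi> j. enn2real (\<theta> j 1))"
  interpret ces_consumer r w a
    using range w in_class_A_coefficients[OF u u_proper] by unfold_locales (auto simp: a_def)
  have \<theta>: "homogeneous_component r (\<theta> j)" for j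
    using u by (simp add: in_class_A_def)
  have d0: "0 < d" using u d by (simp add: in_class_A_def)
  have x_eq: "x q = demand q" if "\<forall>j. 0 < q $ j" for q
    unfolding x v by (rule best_response_eq_demand[OF u a_def that])
  have fr_eq: "fr q = k * ln (power_sum a r (demand q))" if "\<forall>j. 0 < q $ j" for q
    unfolding fr f v by (simp add: opt_value_eq[OF u a_def that])
  \<comment> \<open>The vector \<open>g = P\<^sup>-\<^sup>1 \<gamma>\<close>; the budget identity becomes \<open>p \<bullet> g = 1\<close>.\<close>
  define g where "g = (1 / w) *\<^sub>R demand p"
  have \<gamma>_nth: "\<gamma> $ j = p $ j * g $ j" for j
    by (simp add: \<gamma> x_eq[OF p] shares_demand[OF \<theta> a_def p] g_def)
  have pg: "p \<bullet> g = 1"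
    using w by (simp add: g_def demand_spends_budget[OF p])
  hence g0: "g \<noteq> 0" by auto
  have p0: "p $ j \<noteq> 0" for j using p by (metis less_irrefl)
  hence pn: "p \<noteq> 0" by (metis zero_index)

  have simplex: "\<gamma> \<in> unit_simplex"
    using pg p demand_nonneg[OF p] w
    by (simp add: unit_simplex_def \<gamma>_nth inner_vec_def g_def less_imp_le)
  have \<gamma>_eq: "\<gamma> = (1 / w) *\<^sub>R (X *v p)"
    by (simp add: vec_eq_iff \<gamma>_nth X diag_mult_vec x_eq[OF p] g_def mult.commute)

  define M where "M = diag (\<chi> j. g $ j / p $ j) - r *\<^sub>R outer g g"
  have M: "substitution_matrix p = M"
    by (simp add: M_def g_def)
  have M_eq: "matrix_inv P ** (\<Gamma> - r *\<^sub>R outer \<gamma> \<gamma>) ** matrix_inv P = M"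
    using p0 by (simp add: P matrix_inv_diag vec_eq_iff matrix_mult_diag_left matrix_mult_diag_right
        \<Gamma> M_def diag_nth outer_nth \<gamma>_nth field_simps)
  have DR1_M: "DR1 (c *\<^sub>R M)" if "c \<noteq> 0" for c
  proof -
    have "c *\<^sub>R M = diag (\<chi> j. c * (g $ j / p $ j)) + (- c * r) *\<^sub>R outer g g"
      by (simp add: M_def vec_eq_iff diag_nth outer_nth algebra_simps)
    thus ?thesis
      using DR1_diag_plus_outer[of "- c * r" g] that g0 r by simp
  qed

  have hess_fr: "twice_differentiable_at fr p" "hessian fr p = (d / (1 - r)) *\<^sub>R M"
    unfolding d M[symmetric] by (rule dual_hessian[OF p fr_eq], assumption)+

  have deriv_x: "(x has_derivative (*v) (- (w / (1 - r)) *\<^sub>R M)) (at p)"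
    using demand_has_derivative[OF p] unfolding M
    by (rule has_derivative_transform_within_open[OF _ open_positive_orthant]) (use p x_eq in auto)
  hence jac_x: "jacobian_at x p = - (w / (1 - r)) *\<^sub>R M"
    by (rule jacobian_at_eqI)

  have primal: "twice_differentiable_at vr (x p)
        \<and> hessian vr (x p) = (d * (1 - r) / w\<^sup>2) *\<^sub>R (P ** matrix_inv \<Gamma> ** P)
                              + (d * r / w\<^sup>2) *\<^sub>R outer p p
        \<and> invertible (hessian vr (x p))
        \<and> hessian fr p = (d\<^sup>2 / w\<^sup>2) *\<^sub>R matrix_inv (hessian vr (x p))
        \<and> DR1 (hessian vr (x p))"
    if \<gamma>_pos: "\<forall>j. 0 < \<gamma> $ j"
  proof -
    have g_pos: "0 < g $ j" for j
      using \<gamma>_pos p by (metis \<gamma>_nth zero_less_mult_pos)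
    hence g_ne: "g $ j \<noteq> 0" for j
      by (metis less_irrefl)
    have a_pos: "\<forall>j. 0 < a $ j"
      using g_pos w by (simp add: g_def zero_less_divide_iff demand_pos_iff[OF p])
    have vr_eq: "vr z = - k * ln (power_sum a r z)" if z: "\<forall>j. 0 < z $ j" for z
    proof -
      have "finite_at z" "0 < power_sum a r z" "z \<in> orthant"
        using z a_pos by (auto simp: finite_at_def orthant_def less_imp_le intro!: power_sum_pos)
      thus ?thesis
        by (simp add: vr v log_utility_eq[OF u a_def])
    qed
    \<comment> \<open>The factor \<open>\<mu>\<close> for which the diagonal part of the primal Hessian maps \<open>g\<close> to \<open>\<mu> p\<close>.\<close>
    define \<mu> where "\<mu> = d * (1 - r) / w\<^sup>2"
    define \<alpha> where "\<alpha> = (\<chi> j. \<mu> * p $ j / g $ j)"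
    define s where "s = d * r / w\<^sup>2"
    have \<mu>: "\<mu> \<noteq> 0" using d0 r w by (simp add: \<mu>_def)
    have "(\<chi> j. k * r * (1 - r) * p $ j / (w * demand p $ j)) = \<alpha>"
      using w by (simp add: \<alpha>_def \<mu>_def d g_def vec_eq_iff power2_eq_square)
    moreover have "hessian vr (demand p)
        = diag (\<chi> j. k * r * (1 - r) * p $ j / (w * demand p $ j)) + (k * r * r / w\<^sup>2) *\<^sub>R outer p p"
      by (rule primal_hessian(2)[OF p a_pos vr_eq])
    ultimately have hess_vr: "hessian vr (x p) = diag \<alpha> + s *\<^sub>R outer p p"
      by (simp only: x_eq[OF p] s_def d)
    have diff_vr: "twice_differentiable_at vr (x p)"
      unfolding x_eq[OF p] by (rule primal_hessian(1)[OF p a_pos vr_eq])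
    have "matrix_inv \<Gamma> = diag (\<chi> j. 1 / \<gamma> $ j)"
      unfolding \<Gamma> by (rule matrix_inv_diag) (use \<gamma>_pos in \<open>metis less_irrefl\<close>)
    hence "\<mu> *\<^sub>R (P ** matrix_inv \<Gamma> ** P) = diag \<alpha>"
      using p0 by (simp add: vec_eq_iff P matrix_mult_diag_left matrix_mult_diag_right diag_nth \<alpha>_def \<gamma>_nth)
    hence formula: "hessian vr (x p) = \<mu> *\<^sub>R (P ** matrix_inv \<Gamma> ** P) + s *\<^sub>R outer p p"
      by (simp add: hess_vr)

    have prod: "(diag \<alpha> + s *\<^sub>R outer p p) ** (diag (\<chi> j. g $ j / (\<mu> * p $ j)) + (- r / \<mu>) *\<^sub>R outer g g) = mat 1"
    proof (rule diag_plus_outer_inverse[OF \<mu> pg])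
      have s: "s / \<mu> = r / (1 - r)"
        using d0 r w by (simp add: s_def \<mu>_def)
      have "\<mu> * (- r / \<mu>) + s / \<mu> + s * (- r / \<mu>) = (s / \<mu>) * (1 - r) - r"
        using \<mu> by (simp add: algebra_simps diff_divide_distrib)
      thus "\<mu> * (- r / \<mu>) + s / \<mu> + s * (- r / \<mu>) = 0"
        using r by (simp add: s)
    qed (use p0 \<mu> g_ne in \<open>auto simp: \<alpha>_def\<close>)
    have "diag (\<chi> j. g $ j / (\<mu> * p $ j)) + (- r / \<mu>) *\<^sub>R outer g g = (1 / \<mu>) *\<^sub>R M"
      by (simp add: M_def vec_eq_iff diag_nth outer_nth diff_divide_distrib)
    with matrix_inv_eqI[OF prod] hess_vr
    have inv: "invertible (hessian vr (x p))" "matrix_inv (hessian vr (x p)) = (1 / \<mu>) *\<^sub>R M"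
      by simp_all
    have "d / (1 - r) = d\<^sup>2 / w\<^sup>2 * (1 / \<mu>)"
      using d0 w by (simp add: \<mu>_def power2_eq_square)
    hence dual: "hessian fr p = (d\<^sup>2 / w\<^sup>2) *\<^sub>R matrix_inv (hessian vr (x p))"
      by (simp only: hess_fr inv scaleR_scaleR)
    have "s \<noteq> 0" using d0 r w by (simp add: s_def)
    hence "DR1 (hessian vr (x p))"
      unfolding hess_vr by (rule DR1_diag_plus_outer) (rule pn)
    with diff_vr formula inv(1) dual show ?thesis
      unfolding \<mu>_def s_def by blast
  qed

  have c: "d / (1 - r) \<noteq> 0" "- (w / (1 - r)) \<noteq> 0"
    using d0 r w by auto
  have "- (w / (1 - r)) = - (w / d * (d / (1 - r)))"
    using d0 by simp
  hence jac_hess: "jacobian_at x p = - ((w / d) *\<^sub>R hessian fr p)"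
    unfolding jac_x hess_fr by (simp only: scaleR_scaleR scaleR_minus_left)
  have jac: "jacobian_at x p = - ((w / (1 - r)) *\<^sub>R M)"
    by (simp only: jac_x scaleR_minus_left)
  have DR1s: "DR1 (hessian fr p)" "DR1 (jacobian_at x p)"
    unfolding hess_fr jac_x by (rule DR1_M[OF c(1)], rule DR1_M[OF c(2)])
  show ?thesis
    unfolding M_eq
    by (intro conjI impI \<gamma>_eq simplex primal hess_fr differentiableI[OF deriv_x] jac_hess jac DR1s)
qed

end
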